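(* Let $X$ be a compact uniform space with uniformity $\mathcal{U}$. If $X$ admits a topologically expansive homeomorphism $f:X\to X$, then $X$ is metrizable.
   Context: A uniform space $(X,\mathcal{U})$ carries the topology in which a set $T\subseteq X$ is open iff for every $x\in T$ there is $U\in\mathcal{U}$ with $U[x]=\{y : (x,y)\in U\}\subseteq T$; topological terms (compact, homeomorphism, metrizable) refer to this topology, and compactness does not presuppose Hausdorff. Members of $\mathcal{U}$ are called entourages. For an entourage $D\in\mathcal{U}$, a homeomorphism $f:X\to X$ and $x\in X$, let $\Gamma_D(x,f)=\{y\in X : (f^n(x),f^n(y))\in D \text{ for all } n\in\mathbb{Z}\}$. A homeomorphism $f:X\to X$ is topologically expansive if there exists an entourage $A\in\mathcal{U}$ such that $\Gamma_A(x,f)=\{x\}$ for every $x\in X$. *)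

theory Defs
  imports "HOL-Analysis.Analysis"
begin

text \<open>
  A uniform space is a type of class \<^class>\<open>uniform_space\<close>. The library represents the
  uniformity by the filter \<^const>\<open>uniformity\<close>, whose members are the entourages.
  The class axiom \<open>open_uniformity\<close> makes the topology of the type the uniform topology;
  no separation axiom is included.
\<close>

definition entourage :: "('a::uniform_space \<times> 'a) set \<Rightarrow> bool" where
  "entourage D \<longleftrightarrow> eventually (\<lambda>p. p \<in> D) uniformity"

text \<open>Only meaningful for bijective \<open>f\<close>, as \<^const>\<open>inv\<close> is Hilbert-choice based.\<close>

definition int_iterate :: "('a \<Rightarrow> 'a) \<Rightarrow> int \<Rightarrow> 'a \<Rightarrow> 'a" where
  "int_iterate f n = (if n \<ge> 0 then f ^^ nat n else inv f ^^ nat (- n))"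

definition Gamma_set :: "('a \<times> 'a) set \<Rightarrow> 'a \<Rightarrow> ('a \<Rightarrow> 'a) \<Rightarrow> 'a set" where
  "Gamma_set D x f = {y. \<forall>n::int. (int_iterate f n x, int_iterate f n y) \<in> D}"

definition topologically_expansive :: "('a::uniform_space \<Rightarrow> 'a) \<Rightarrow> bool" where
  "topologically_expansive f \<longleftrightarrow> (\<exists>A. entourage A \<and> (\<forall>x. Gamma_set A x f = {x}))"

end

theory Submission
  imports Defs
begin

text \<open>
  The iterates of \<open>f\<close> form a countable family of continuous maps, and expansiveness says that
  distinct points are moved by one of them to a pair outside a fixed entourage \<open>A\<close>.

  Since \<open>A\<close> is a neighbourhood of the diagonal, the preimages of its interior under the maps
  \<open>(x, y) \<mapsto> (f\<^sup>n x, f\<^sup>n y)\<close> are countably many open sets, and they intersect exactly in the diagonal,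
  which is therefore a \<open>G\<^sub>\<delta>\<close> set. Moreover, points whose \<open>n\<close>-th images are not \<open>A\<close>-close have
  disjoint neighbourhoods, because their images have; so the space is Hausdorff. Both facts enter
  the lemma \<open>metrizable_space_countably_many_separating_maps\<close>.

  It remains to see that a compact Hausdorff space \<open>X\<close> with \<open>G\<^sub>\<delta>\<close> diagonal is metrizable
  (\<open>compact_Hausdorff_gdelta_diagonal_imp_metrizable\<close>). The complement of the diagonal in \<open>X \<times> X\<close>
  is a countable union of compact sets. The sets \<open>{(x, y). g x \<noteq> g y}\<close> with \<open>g\<close> real-valued
  and continuous are open and cover it by Urysohn's lemma, so, by compactness, countably many \<open>g\<close>
  already separate the points of \<open>X\<close>. These embed \<open>X\<close> into a countable power of the reals. Working with the
  diagonal avoids constructing a countable base of the uniformity or a metric by hand.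
\<close>

section \<open>Compact Hausdorff spaces with a G-delta diagonal\<close>

text \<open>
  A continuous injection of a compact space into a Hausdorff space is an embedding, and a product
  of countably many lines is metrizable.
\<close>

lemma compact_countably_separated_imp_metrizable:
  fixes G :: "('a \<Rightarrow> real) set"
  assumes "compact_space X" and "countable G"
    and cont: "\<And>g. g \<in> G \<Longrightarrow> continuous_map X euclideanreal g"
    and sep: "\<And>x y. \<lbrakk>x \<in> topspace X; y \<in> topspace X; x \<noteq> y\<rbrakk> \<Longrightarrow> \<exists>g\<in>G. g x \<noteq> g y"
  shows "metrizable_space X"
proof -
  let ?P = "powertop_real G" and ?e = "\<lambda>x. \<lambda>g\<in>G. g x"
  have metr: "metrizable_space ?P"
    using \<open>countable G\<close>
    by (simp add: metrizable_space_product_topology metrizable_space_euclidean)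
  have cont_e: "continuous_map X ?P ?e"
    using cont by (simp add: continuous_map_componentwise image_subset_iff)
  have "inj_on ?e (topspace X)"
  proof (rule inj_onI, rule ccontr)
    fix x y assume "x \<in> topspace X" "y \<in> topspace X" "?e x = ?e y" "x \<noteq> y"
    then obtain g where "g \<in> G" "g x \<noteq> g y"
      using sep by blast
    then show False
      using fun_cong [OF \<open>?e x = ?e y\<close>, of g] by simp
  qed
  then have "embedding_map X ?P ?e"
    using continuous_imp_closed_map [OF cont_e \<open>compact_space X\<close> metrizable_imp_Hausdorff_space [OF metr]]
      cont_e by (intro injective_closed_imp_embedding_map) auto
  then have "X homeomorphic_space subtopology ?P (?e ` topspace X)"
    by (rule embedding_map_imp_homeomorphic_space)
  then show ?thesis
    using homeomorphic_metrizable_space metr metrizable_space_subtopology by blast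
qed

text \<open>
  Finitely many Urysohn functions suffice on a compact set off the diagonal, because a function
  that separates the two entries of a pair does so for all nearby pairs.
\<close>

lemma finite_separating_functions_off_diagonal:
  assumes "compact_space X" and "Hausdorff_space X"
    and K: "compactin (prod_topology X X) K"
    and off: "\<And>x. (x, x) \<notin> K"
  obtains G :: "('a \<Rightarrow> real) set"
  where "finite G" and "\<And>g. g \<in> G \<Longrightarrow> continuous_map X euclideanreal g"
    and "\<And>x y. (x, y) \<in> K \<Longrightarrow> \<exists>g\<in>G. g x \<noteq> g y"
proof -
  define C where "C = {g :: 'a \<Rightarrow> real. continuous_map X euclideanreal g}"
  define W where "W g = {p \<in> topspace (prod_topology X X). g (fst p) - g (snd p) \<in> - {0}}"
    for g :: "'a \<Rightarrow> real"
  have normal: "normal_space X"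
    using assms compact_Hausdorff_or_regular_imp_normal_space by blast
  have "openin (prod_topology X X) (W g)" if "g \<in> C" for g
  proof -
    have "continuous_map (prod_topology X X) euclideanreal (\<lambda>p. g (fst p) - g (snd p))"
      using that continuous_map_compose [OF continuous_map_fst, of X euclideanreal g X]
        continuous_map_compose [OF continuous_map_snd, of X euclideanreal g X]
      by (intro continuous_map_diff) (auto simp: C_def o_def)
    then show ?thesis
      unfolding W_def by (rule openin_continuous_map_preimage) (simp add: open_Compl)
  qed
  moreover have "K \<subseteq> \<Union> (W ` C)"
  proof
    fix p assume "p \<in> K"
    then obtain x y where p: "p = (x, y)" "x \<in> topspace X" "y \<in> topspace X" "x \<noteq> y"
      using compactin_subset_topspace [OF K] off by (cases p) auto
    have "closedin X {x}" "closedin X {y}"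
      using p \<open>Hausdorff_space X\<close> by (simp_all add: closedin_Hausdorff_singleton)
    then obtain g where "continuous_map X euclideanreal g" "g ` {x} \<subseteq> {0::real}" "g ` {y} \<subseteq> {1}"
      using Urysohn_lemma_alt [OF normal, of "{x}" "{y}" 0 1] p by auto
    then show "p \<in> \<Union> (W ` C)"
      using p by (auto simp: C_def W_def)
  qed
  ultimately obtain F where "finite F" "F \<subseteq> W ` C" "K \<subseteq> \<Union> F"
    using compactinD [OF K, of "W ` C"] by blast
  then obtain G where "G \<subseteq> C" "finite G" "F = W ` G"
    by (meson finite_subset_image)
  with \<open>K \<subseteq> \<Union> F\<close> show thesis
    by (intro that [of G]) (auto simp: C_def W_def subset_iff Bex_def)
qed

text \<open>
  The complement of the diagonal is a countable union of closed subsets of a compact space, so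
  that the finite families of the previous lemma combine to a countable one.
\<close>

theorem compact_Hausdorff_gdelta_diagonal_imp_metrizable:
  assumes "compact_space X" and "Hausdorff_space X"
    and diag: "gdelta_in (prod_topology X X) ((\<lambda>x. (x, x)) ` topspace X)"
  shows "metrizable_space X"
proof -
  let ?XX = "prod_topology X X"
  have "fsigma_in ?XX (topspace ?XX - (\<lambda>x. (x, x)) ` topspace X)"
    using diag by (simp add: gdelta_in_fsigma_in)
  then obtain K :: "nat \<Rightarrow> ('a \<times> 'a) set" where closed: "\<And>n. closedin ?XX (K n)"
    and Un: "(\<Union>n. K n) = topspace ?XX - (\<lambda>x. (x, x)) ` topspace X"
    unfolding fsigma_in_ascending by blast
  have compact: "compactin ?XX (K n)" for n
    using assms(1) closed by (simp add: closedin_compact_space compact_space_prod_topology)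
  have off: "(x, x) \<notin> K n" for x n
    using Un by auto
  have "\<exists>G :: ('a \<Rightarrow> real) set. finite G \<and> (\<forall>g\<in>G. continuous_map X euclideanreal g)
          \<and> (\<forall>x y. (x, y) \<in> K n \<longrightarrow> (\<exists>g\<in>G. g x \<noteq> g y))" for n
    by (rule finite_separating_functions_off_diagonal [OF assms(1,2) compact off]) blast
  then obtain G :: "nat \<Rightarrow> ('a \<Rightarrow> real) set" where G: "\<And>n. finite (G n)"
    "\<And>n g. g \<in> G n \<Longrightarrow> continuous_map X euclideanreal g"
    "\<And>n x y. (x, y) \<in> K n \<Longrightarrow> \<exists>g \<in> G n. g x \<noteq> g y"
    by metis
  show ?thesis
  proof (rule compact_countably_separated_imp_metrizable [OF \<open>compact_space X\<close>])
    show "countable (\<Union>n. G n)"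
      using G(1) by (simp add: countable_finite)
    show "\<exists>g \<in> \<Union>n. G n. g x \<noteq> g y" if "x \<in> topspace X" "y \<in> topspace X" "x \<noteq> y" for x y
    proof -
      have "(x, y) \<in> (\<Union>n. K n)"
        using that Un by auto
      then show ?thesis
        using G(3) by blast
    qed
  qed (use G(2) in blast)
qed

section \<open>Separation by an entourage\<close>

lemma small_open_neighbourhood:
  assumes "entourage D"
  obtains U where "open U" "x \<in> U" "U \<times> U \<subseteq> D"
proof -
  obtain E where E: "eventually E uniformity"
    and trans: "\<And>x y z. E (x, y) \<Longrightarrow> E (y, z) \<Longrightarrow> (x, z) \<in> D"
    using assms unfolding entourage_def by (rule uniformity_transE) blast
  \<comment> \<open>Symmetrizing \<open>E\<close> lets two points near \<open>x\<close> be joined through \<open>x\<close>.\<close>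
  have "eventually (\<lambda>(x', y). x' = x \<longrightarrow> E (x, y) \<and> E (y, x)) uniformity"
    using E uniformity_sym [OF E] by eventually_elim auto
  then have "eventually (\<lambda>y. E (x, y) \<and> E (y, x)) (nhds x)"
    by (simp add: eventually_nhds_uniformity)
  then obtain U where "open U" "x \<in> U" "\<forall>y\<in>U. E (x, y) \<and> E (y, x)"
    unfolding eventually_nhds by blast
  then show thesis
    by (intro that [of U]) (auto intro: trans)
qed

text \<open>
  A common point of small neighbourhoods of \<open>x\<close> and \<open>y\<close> would join \<open>x\<close> to \<open>y\<close> within \<open>D\<close>.
\<close>

lemma disjoint_neighbourhoods_if_not_close:
  assumes "entourage D" and "(x, y) \<notin> D"
  obtains U V where "open U" "open V" "x \<in> U" "y \<in> V" "U \<inter> V = {}"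
proof -
  obtain E where E: "eventually E uniformity"
    and trans: "\<And>x y z. E (x, y) \<Longrightarrow> E (y, z) \<Longrightarrow> (x, z) \<in> D"
    using assms(1) unfolding entourage_def by (rule uniformity_transE) blast
  have "entourage (Collect E)"
    using E by (simp add: entourage_def)
  then obtain U V where "open U" "x \<in> U" "U \<times> U \<subseteq> Collect E"
    and "open V" "y \<in> V" "V \<times> V \<subseteq> Collect E"
    by (metis small_open_neighbourhood)
  moreover have False if "w \<in> U" "w \<in> V" for w
    using calculation that trans [of x w y] \<open>(x, y) \<notin> D\<close> by blast
  ultimately show thesis
    by (intro that [of U V]) auto
qed

text \<open>
  Pulling back disjoint neighbourhoods of images that are not close gives the Hausdorff property.
  Pulling back the interior of the entourage, which contains the diagonal, gives countably many
  open sets whose intersection is the diagonal.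
\<close>

lemma metrizable_space_countably_many_separating_maps:
  fixes h :: "'i \<Rightarrow> 'a::topological_space \<Rightarrow> 'b::uniform_space"
  assumes compact: "compact (UNIV :: 'a set)" and "countable I"
    and cont: "\<And>i. i \<in> I \<Longrightarrow> continuous_map euclidean euclidean (h i)"
    and D: "entourage D"
    and sep: "\<And>x y. x \<noteq> y \<Longrightarrow> \<exists>i\<in>I. (h i x, h i y) \<notin> D"
  shows "metrizable_space (euclidean :: 'a topology)"
proof (rule compact_Hausdorff_gdelta_diagonal_imp_metrizable)
  let ?X = "euclidean :: 'a topology" and ?Y = "euclidean :: 'b topology"
  show "compact_space ?X"
    using compact by (simp add: compact_space_def)
  show "Hausdorff_space ?X"
    unfolding Hausdorff_space_def
  proof (intro allI impI, elim conjE)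
    fix x y :: 'a assume "x \<noteq> y"
    then obtain i where i: "i \<in> I" "(h i x, h i y) \<notin> D"
      using sep by blast
    obtain U V where UV: "open U" "open V" "h i x \<in> U" "h i y \<in> V" "U \<inter> V = {}"
      using disjoint_neighbourhoods_if_not_close [OF D i(2)] .
    have "openin ?X (h i -` U)" "openin ?X (h i -` V)"
      using openin_continuous_map_preimage [OF cont [OF i(1)]] UV by (simp_all add: vimage_def)
    then show "\<exists>U V. openin ?X U \<and> openin ?X V \<and> x \<in> U \<and> y \<in> V \<and> disjnt U V"
      using UV by (intro exI [of _ "h i -` U"] exI [of _ "h i -` V"]) (auto simp: disjnt_def)
  qed
  define N where "N = prod_topology ?Y ?Y interior_of D"
  have "(z, z) \<in> N" for z
  proof -
    obtain U where "open U" "z \<in> U" "U \<times> U \<subseteq> D"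
      using small_open_neighbourhood [OF D] .
    then show ?thesis
      unfolding N_def interior_of_def
      by (auto intro!: exI [of _ "U \<times> U"] simp: open_Times)
  qed
  moreover have "N \<subseteq> D"
    unfolding N_def by (rule interior_of_subset)
  ultimately have diag: "range (\<lambda>x. (x, x)) = (\<Inter>i\<in>I. {p. (h i (fst p), h i (snd p)) \<in> N})"
    using sep by fastforce
  have openN: "openin (prod_topology ?X ?X) {p. (h i (fst p), h i (snd p)) \<in> N}" if "i \<in> I" for i
  proof -
    have "continuous_map (prod_topology ?X ?X) (prod_topology ?Y ?Y)
            (\<lambda>p. (h i (fst p), h i (snd p)))"
      using continuous_map_compose [OF continuous_map_fst cont [OF that], of ?X]
        continuous_map_compose [OF continuous_map_snd cont [OF that], of ?X]
      by (intro continuous_map_pairedI) (simp_all add: o_def)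
    from openin_continuous_map_preimage [OF this, of N] show ?thesis
      by (simp add: N_def)
  qed
  show "gdelta_in (prod_topology ?X ?X) ((\<lambda>x. (x, x)) ` topspace ?X)"
  proof (cases "I = {}")
    case True
    \<comment> \<open>Without any map the space has at most one point, and the diagonal is everything.\<close>
    then have "(\<lambda>x. (x, x)) ` topspace ?X = topspace (prod_topology ?X ?X)"
      using diag by simp
    then show ?thesis
      by (simp only: gdelta_in_topspace)
  next
    case False
    then show ?thesis
      unfolding topspace_euclidean diag using \<open>countable I\<close> openN
      by (intro gdelta_in_Inter) (auto intro: open_imp_gdelta_in)
  qed
qed

section \<open>Expansive homeomorphisms\<close>

lemma continuous_map_int_iterate:
  assumes "homeomorphic_map euclidean euclidean f"
  shows "continuous_map euclidean euclidean (int_iterate f n)"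
proof -
  have power: "continuous_map euclidean euclidean (g ^^ k)"
    if "continuous_map euclidean euclidean g" for g :: "'a \<Rightarrow> 'a" and k
  proof (induction k)
    case (Suc k)
    then show ?case
      using that by (simp only: funpow.simps continuous_map_compose)
  qed (simp only: funpow.simps continuous_map_id)
  obtain g where g: "homeomorphic_maps euclidean euclidean f g"
    using assms by (auto simp: homeomorphic_map_maps)
  then have "inv f = g"
    by (intro inv_equality) (auto simp: homeomorphic_maps_def)
  with g have "continuous_map euclidean euclidean f" "continuous_map euclidean euclidean (inv f)"
    by (auto simp: homeomorphic_maps_def)
  then show ?thesis
    using power by (cases "0 \<le> n") (simp_all only: int_iterate_def if_True if_False)
qed

theorem corollary3p10:
  fixes f :: "'a::uniform_space \<Rightarrow> 'a"
  assumes "compact (UNIV :: 'a set)"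
    and "homeomorphic_map euclidean euclidean f"
    and "topologically_expansive f"
  shows "metrizable_space (euclidean :: 'a topology)"
proof -
  obtain A where A: "entourage A" and Gamma: "\<And>x. Gamma_set A x f = {x}"
    using assms(3) by (auto simp: topologically_expansive_def)
  have "\<exists>n \<in> UNIV. (int_iterate f n x, int_iterate f n y) \<notin> A" if "x \<noteq> y" for x y
    using Gamma [of x] that by (auto simp: Gamma_set_def)
  then show ?thesis
    by (intro metrizable_space_countably_many_separating_maps
        [where h = "int_iterate f" and I = UNIV and D = A])
      (simp_all only: assms(1) A countableI_type continuous_map_int_iterate [OF assms(2)])
qed

end
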